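(* Let $f=(f_1,\ldots,f_p)\colon\mathbb{R}^n\to\mathbb{R}^p$, $g=(g_1,\ldots,g_m)\colon\mathbb{R}^n\to\mathbb{R}^m$ and $h=(h_1,\ldots,h_r)\colon\mathbb{R}^n\to\mathbb{R}^r$ have locally Lipschitz components, and let $\mathcal{F}=\{x\in\mathbb{R}^n : g_i(x)\le 0\ (i=1,\ldots,m),\ h_j(x)=0\ (j=1,\ldots,r)\}$. Let $\bar x\in\mathcal{F}$ and let $\{x^k\}_{k\in\mathbb{N}}\subset\mathbb{R}^n$ and $\{(\lambda^k,\mu^k,\tau^k)\}_{k\in\mathbb{N}}\subset\mathbb{R}^p_+\times\mathbb{R}^m_+\times\mathbb{R}^r$ be sequences satisfying the AKKT condition at $\bar x$ and such that, for every $k\in\mathbb{N}$, there are $b_k,c_k>0$ with $\mu_i^k=b_k\max(g_i(x^k),0)\ge0$ for all $i\in\{1,\ldots,m\}$ and $\tau_j^k=c_kh_j(x^k)\ge0$ for all $j\in\{1,\ldots,r\}$. If the quasi-normality constraint qualification (QNCQ) holds at $\bar x$, then $\bar x$ satisfies the KKT optimality condition.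
   Context: $\mathbb{R}^n$ carries the Euclidean inner product and norm; $\mathbb{R}^p_+$ is the nonnegative orthant of $\mathbb{R}^p$; $\mathbb{N}=\{1,2,\ldots\}$. Subdifferential. For $S\subset\mathbb{R}^n$, $x\in S$ and $\varepsilon\ge 0$, the set of $\varepsilon$-normals is $\widehat N_\varepsilon(x;S)=\{z^*\in\mathbb{R}^n : \limsup_{u\to x,\,u\in S}\frac{\langle z^*,u-x\rangle}{\|u-x\|}\le\varepsilon\}$. For $\bar x\in\mathrm{cl}\,S$, the Mordukhovich (limiting) normal cone $N(\bar x;S)$ is the set of all $z^*\in\mathbb{R}^n$ for which there are $x^k\in S$ with $x^k\to\bar x$, $\varepsilon_k\to0^+$ and $z_k^*\to z^*$ with $z^*_k\in\widehat N_{\varepsilon_k}(x^k;S)$ for all $k$. For $\varphi\colon\mathbb{R}^n\to\mathbb{R}$, the Mordukhovich (limiting) subdifferential at $\bar x$ is $\partial\varphi(\bar x)=\{x^*\in\mathbb{R}^n : (x^*,-1)\in N((\bar x,\varphi(\bar x));\mathrm{epi}\,\varphi)\}$, where $\mathrm{epi}\,\varphi=\{(x,\alpha)\in\mathbb{R}^n\times\mathbb{R} : \alpha\ge\varphi(x)\}$. AKKT condition. Sequences $\{x^k\}\subset\mathbb{R}^n$ and $\{(\lambda^k,\mu^k,\tau^k)\}\subset\mathbb{R}^p_+\times\mathbb{R}^m_+\times\mathbb{R}^r$ satisfy the approximate Karush--Kuhn--Tucker (AKKT) condition at $\bar x\in\mathcal{F}$ if: (A0) $x^k\to\bar x$; (A1)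 $\mathfrak{m}(x^k;\lambda^k,\mu^k,\tau^k)\to0$ as $k\to\infty$, where $\mathfrak{m}(x^k;\lambda^k,\mu^k,\tau^k)$ is the infimum of $\big\|\sum_{l=1}^p\lambda_l^k\xi_l+\sum_{i=1}^m\mu_i^k\eta_i+\sum_{j=1}^r\tau_j^k\gamma_j\big\|$ over all $\xi_l\in\partial f_l(x^k)$, $\eta_i\in\partial g_i(x^k)$, $\gamma_j\in\partial h_j(x^k)\cup\partial(-h_j)(x^k)$; (A2) $\sum_{l=1}^p\lambda_l^k=1$ for all $k$; (A3) for each $i\in\{1,\ldots,m\}$ with $g_i(\bar x)<0$, $\mu_i^k=0$ for all sufficiently large $k$. QNCQ. $\bar x\in\mathcal{F}$ satisfies the quasi-normality constraint qualification if there is no $(\mu,\tau)\in\mathbb{R}^m_+\times\mathbb{R}^r$ such that all of the following hold: (i) $(\mu,\tau)\ne0$; (ii) $0\in\sum_{i=1}^m\mu_i\partial g_i(\bar x)+\sum_{j=1}^r\tau_j[\partial h_j(\bar x)\cup\partial(-h_j)(\bar x)]$; (iii) in every neighborhood of $\bar x$ there is a point $x\in\mathbb{R}^n$ such that $g_i(x)>0$ for all $i$ with $\mu_i>0$ and $\tau_jh_j(x)>0$ for all $j$ with $\tau_j\ne0$. KKT optimality condition. $\bar x\in\mathcal{F}$ satisfies the KKT optimality condition if there exists $(\lambda,\mu,\tau)\in\mathbb{R}^p_+\times\mathbb{R}^m_+\times\mathbb{R}^r$ such that (i) $\lambda\ne0$; (ii) $0\in\sum_{l=1}^p\lambda_l\partial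 f_l(\bar x)+\sum_{i=1}^m\mu_i\partial g_i(\bar x)+\sum_{j=1}^r\tau_j[\partial h_j(\bar x)\cup\partial(-h_j)(\bar x)]$; (iii) $\mu_ig_i(\bar x)=0$ for all $i\in\{1,\ldots,m\}$. *)

theory Defs
  imports "HOL-Analysis.Analysis"
begin

text \<open>
  The numbers of objectives and constraints may be zero, so vectors in R^p, R^m and R^r
  are functions on the naturals of which only the components in \<open>{1..p}\<close>, \<open>{1..m}\<close> and
  \<open>{1..r}\<close> are ever inspected. In the same way sequences are indexed by the positive
  integers: the value at index 0 carries no information.
\<close>

definition locally_lipschitz :: "('a::metric_space \<Rightarrow> real) \<Rightarrow> bool" where
  "locally_lipschitz \<phi> \<longleftrightarrow> (\<forall>x. \<exists>u>0. \<exists>L. L-lipschitz_on (ball x u) \<phi>)"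

subsection \<open>Limiting normals and subgradients\<close>

text \<open>
  The upper limit is taken in the extended reals, over points \<open>u \<noteq> x\<close>; it is
  \<open>-\<infinity>\<close> at an isolated point of \<open>S\<close>, where every vector is therefore normal.
\<close>

definition eps_normals :: "real \<Rightarrow> 'a::euclidean_space \<Rightarrow> 'a set \<Rightarrow> 'a set" where
  "eps_normals \<epsilon> x S =
     {z. Limsup (at x within S) (\<lambda>u. ereal (inner z (u - x) / norm (u - x))) \<le> ereal \<epsilon>}"

definition limiting_normal_cone :: "'a::euclidean_space \<Rightarrow> 'a set \<Rightarrow> 'a set" where
  "limiting_normal_cone x S =
     {z. \<exists>xs \<epsilon> zs. (\<forall>k\<ge>1. xs k \<in> S) \<and> xs \<longlonglongrightarrow> x \<and>
           (\<forall>k\<ge>1. \<epsilon> k > 0) \<and> \<epsilon> \<longlonglongrightarrow> 0 \<and> zs \<longlonglongrightarrow> z \<and>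
           (\<forall>k\<ge>1. zs k \<in> eps_normals (\<epsilon> k) (xs k) S)}"

definition limiting_subdiff :: "('a::euclidean_space \<Rightarrow> real) \<Rightarrow> 'a \<Rightarrow> 'a set" where
  "limiting_subdiff \<phi> x =
     {v. (v, -1) \<in> limiting_normal_cone (x, \<phi> x) (epigraph UNIV \<phi>)}"

definition two_sided_subdiff :: "('a::euclidean_space \<Rightarrow> real) \<Rightarrow> 'a \<Rightarrow> 'a set" where
  "two_sided_subdiff \<phi> x = limiting_subdiff \<phi> x \<union> limiting_subdiff (\<lambda>y. - \<phi> y) x"

subsection \<open>Constrained multiobjective problems\<close>

definition feasible_set ::
  "nat \<Rightarrow> nat \<Rightarrow> (nat \<Rightarrow> 'a \<Rightarrow> real) \<Rightarrow> (nat \<Rightarrow> 'a \<Rightarrow> real) \<Rightarrow> 'a set" where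
  "feasible_set m r g h = {x. (\<forall>i\<in>{1..m}. g i x \<le> 0) \<and> (\<forall>j\<in>{1..r}. h j x = 0)}"

text \<open>The Minkowski sum of the scaled sets \<open>w i C\<^sub>i\<close>; it is \<open>{0}\<close> if \<open>I\<close> is empty.\<close>

definition weighted_set_sum ::
  "nat set \<Rightarrow> (nat \<Rightarrow> real) \<Rightarrow> (nat \<Rightarrow> 'a::real_vector set) \<Rightarrow> 'a set" where
  "weighted_set_sum I w C = {\<Sum>i\<in>I. w i *\<^sub>R v i | v. \<forall>i\<in>I. v i \<in> C i}"

definition constraint_sum ::
  "nat \<Rightarrow> nat \<Rightarrow> (nat \<Rightarrow> 'a::euclidean_space \<Rightarrow> real) \<Rightarrow> (nat \<Rightarrow> 'a \<Rightarrow> real) \<Rightarrow>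
   'a \<Rightarrow> (nat \<Rightarrow> real) \<Rightarrow> (nat \<Rightarrow> real) \<Rightarrow> 'a set" where
  "constraint_sum m r g h x \<mu> \<tau> =
     {b + c | b c. b \<in> weighted_set_sum {1..m} \<mu> (\<lambda>i. limiting_subdiff (g i) x) \<and>
                   c \<in> weighted_set_sum {1..r} \<tau> (\<lambda>j. two_sided_subdiff (h j) x)}"

definition lagrangian_sum ::
  "nat \<Rightarrow> nat \<Rightarrow> nat \<Rightarrow>
   (nat \<Rightarrow> 'a::euclidean_space \<Rightarrow> real) \<Rightarrow> (nat \<Rightarrow> 'a \<Rightarrow> real) \<Rightarrow> (nat \<Rightarrow> 'a \<Rightarrow> real) \<Rightarrow>
   'a \<Rightarrow> (nat \<Rightarrow> real) \<Rightarrow> (nat \<Rightarrow> real) \<Rightarrow> (nat \<Rightarrow> real) \<Rightarrow> 'a set" where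
  "lagrangian_sum p m r f g h x lam \<mu> \<tau> =
     {a + d | a d. a \<in> weighted_set_sum {1..p} lam (\<lambda>l. limiting_subdiff (f l) x) \<and>
                   d \<in> constraint_sum m r g h x \<mu> \<tau>}"

text \<open>Extended-real valued, so that the infimum over the empty set is \<open>\<infinity>\<close>.\<close>

definition stationarity_measure ::
  "nat \<Rightarrow> nat \<Rightarrow> nat \<Rightarrow>
   (nat \<Rightarrow> 'a::euclidean_space \<Rightarrow> real) \<Rightarrow> (nat \<Rightarrow> 'a \<Rightarrow> real) \<Rightarrow> (nat \<Rightarrow> 'a \<Rightarrow> real) \<Rightarrow>
   'a \<Rightarrow> (nat \<Rightarrow> real) \<Rightarrow> (nat \<Rightarrow> real) \<Rightarrow> (nat \<Rightarrow> real) \<Rightarrow> ereal" where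
  "stationarity_measure p m r f g h x lam \<mu> \<tau> =
     (INF v\<in>lagrangian_sum p m r f g h x lam \<mu> \<tau>. ereal (norm v))"

definition AKKT ::
  "nat \<Rightarrow> nat \<Rightarrow> nat \<Rightarrow>
   (nat \<Rightarrow> 'a::euclidean_space \<Rightarrow> real) \<Rightarrow> (nat \<Rightarrow> 'a \<Rightarrow> real) \<Rightarrow> (nat \<Rightarrow> 'a \<Rightarrow> real) \<Rightarrow>
   'a \<Rightarrow> (nat \<Rightarrow> 'a) \<Rightarrow> (nat \<Rightarrow> nat \<Rightarrow> real) \<Rightarrow> (nat \<Rightarrow> nat \<Rightarrow> real) \<Rightarrow>
   (nat \<Rightarrow> nat \<Rightarrow> real) \<Rightarrow> bool" where
  "AKKT p m r f g h xbar x lam \<mu> \<tau> \<longleftrightarrow>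
     (\<forall>k\<ge>1. (\<forall>l\<in>{1..p}. lam k l \<ge> 0) \<and> (\<forall>i\<in>{1..m}. \<mu> k i \<ge> 0)) \<and>
     x \<longlonglongrightarrow> xbar \<and>
     (\<lambda>k. stationarity_measure p m r f g h (x k) (lam k) (\<mu> k) (\<tau> k)) \<longlonglongrightarrow> 0 \<and>
     (\<forall>k\<ge>1. (\<Sum>l\<in>{1..p}. lam k l) = 1) \<and>
     (\<forall>i\<in>{1..m}. g i xbar < 0 \<longrightarrow> (\<forall>\<^sub>F k in sequentially. \<mu> k i = 0))"

definition QNCQ ::
  "nat \<Rightarrow> nat \<Rightarrow> (nat \<Rightarrow> 'a::euclidean_space \<Rightarrow> real) \<Rightarrow> (nat \<Rightarrow> 'a \<Rightarrow> real) \<Rightarrow>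
   'a \<Rightarrow> bool" where
  "QNCQ m r g h xbar \<longleftrightarrow>
     \<not> (\<exists>\<mu> \<tau>. (\<forall>i\<in>{1..m}. \<mu> i \<ge> 0) \<and>
          ((\<exists>i\<in>{1..m}. \<mu> i \<noteq> 0) \<or> (\<exists>j\<in>{1..r}. \<tau> j \<noteq> 0)) \<and>
          0 \<in> constraint_sum m r g h xbar \<mu> \<tau> \<and>
          (\<forall>U. open U \<and> xbar \<in> U \<longrightarrow>
             (\<exists>x\<in>U. (\<forall>i\<in>{1..m}. \<mu> i > 0 \<longrightarrow> g i x > 0) \<and>
                    (\<forall>j\<in>{1..r}. \<tau> j \<noteq> 0 \<longrightarrow> \<tau> j * h j x > 0))))"

definition KKT ::
  "nat \<Rightarrow> nat \<Rightarrow> nat \<Rightarrow>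
   (nat \<Rightarrow> 'a::euclidean_space \<Rightarrow> real) \<Rightarrow> (nat \<Rightarrow> 'a \<Rightarrow> real) \<Rightarrow> (nat \<Rightarrow> 'a \<Rightarrow> real) \<Rightarrow>
   'a \<Rightarrow> bool" where
  "KKT p m r f g h xbar \<longleftrightarrow>
     (\<exists>lam \<mu> \<tau>. (\<forall>l\<in>{1..p}. lam l \<ge> 0) \<and> (\<forall>i\<in>{1..m}. \<mu> i \<ge> 0) \<and>
        (\<exists>l\<in>{1..p}. lam l \<noteq> 0) \<and>
        0 \<in> lagrangian_sum p m r f g h xbar lam \<mu> \<tau> \<and>
        (\<forall>i\<in>{1..m}. \<mu> i * g i xbar = 0))"

end

theory Submission
  imports Defs
begin

text \<open>
  Dividing all multipliers by \<open>1 + \<Sum>\<mu>\<^sub>i + \<Sum>\<tau>\<^sub>j\<close> makes them bounded, and limiting subgradients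
  of locally Lipschitz functions are locally bounded with closed graph, so along a subsequence
  everything converges and the limits satisfy the multiplier inclusion at \<open>xbar\<close>. If the limit
  of the scaled objective multipliers is nonzero, this is the KKT condition. Otherwise the
  limits of the constraint multipliers are nonzero and violate QNCQ, the points of the
  subsequence being the witnesses required in its third item.
\<close>

subsection \<open>Limiting normals and subgradients\<close>

lemma eps_normals_mono:
  assumes "\<epsilon> \<le> \<delta>"
  shows "eps_normals \<epsilon> x S \<subseteq> eps_normals \<delta> x S"
  using assms by (auto simp: eps_normals_def elim!: order_trans)

text \<open>An upper limit of at most \<epsilon> bounds the quotients near \<open>x\<close> only by
  numbers strictly above \<epsilon>, hence the slack \<open>c\<close>. The filter excludes
  \<open>u = x\<close>, so the denominator is positive and can be cleared.\<close>

lemma eps_normals_eventually: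
  assumes "z \<in> eps_normals \<epsilon> x S" and "\<epsilon> < c"
  shows "\<forall>\<^sub>F u in at x within S. inner z (u - x) \<le> c * norm (u - x)"
proof -
  have "Limsup (at x within S) (\<lambda>u. ereal (inner z (u - x) / norm (u - x))) < ereal c"
    using assms by (auto simp: eps_normals_def intro: le_less_trans)
  then have "\<forall>\<^sub>F u in at x within S. ereal (inner z (u - x) / norm (u - x)) < ereal c"
    by (rule Limsup_lessD)
  moreover have "\<forall>\<^sub>F u in at x within S. u \<noteq> x"
    by (simp add: eventually_at_filter)
  ultimately show ?thesis
    by eventually_elim (simp add: field_simps)
qed

text \<open>A sequence-free form of the cone: since \<epsilon>-normals grow with \<epsilon>, a
  single tolerance \<open>e\<close> can control the base point, the vector and the degree of
  normality at once. Conversely, the tolerances \<open>1 / (k + 1)\<close> rebuild the three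
  sequences.\<close>

lemma limiting_normal_cone_iff:
  "z \<in> limiting_normal_cone x S \<longleftrightarrow>
     (\<forall>e>0. \<exists>y w. y \<in> S \<and> dist y x < e \<and> dist w z < e \<and> w \<in> eps_normals e y S)"
    (is "?L \<longleftrightarrow> ?R")
proof
  assume ?L
  then obtain xs \<epsilon> zs where
    S: "\<And>k. k \<ge> 1 \<Longrightarrow> xs k \<in> S \<and> zs k \<in> eps_normals (\<epsilon> k) (xs k) S"
    and lim: "xs \<longlonglongrightarrow> x" "\<epsilon> \<longlonglongrightarrow> 0" "zs \<longlonglongrightarrow> z"
    unfolding limiting_normal_cone_def by blast
  show ?R
  proof (intro allI impI)
    fix e :: real
    assume "e > 0"
    have "\<forall>\<^sub>F k in sequentially. dist (xs k) x < e \<and> dist (zs k) z < e \<and> \<epsilon> k < e \<and> k \<ge> 1"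
      using lim \<open>e > 0\<close>
      by (intro eventually_conj tendstoD eventually_ge_at_top order_tendstoD(2)) auto
    then obtain k where "dist (xs k) x < e" "dist (zs k) z < e" "\<epsilon> k < e" "k \<ge> 1"
      by (auto dest: eventually_happens)
    then show "\<exists>y w. y \<in> S \<and> dist y x < e \<and> dist w z < e \<and> w \<in> eps_normals e y S"
      using S[of k] eps_normals_mono[of "\<epsilon> k" e "xs k" S] by (meson less_imp_le subsetD)
  qed
next
  assume ?R
  define e where "e k = inverse (real (Suc k))" for k
  have e: "e k > 0" for k
    by (simp add: e_def)
  have e0: "e \<longlonglongrightarrow> 0"
    unfolding e_def by (rule LIMSEQ_inverse_real_of_nat)
  have "\<forall>k. \<exists>y w. y \<in> S \<and> dist y x < e k \<and> dist w z < e k \<and> w \<in> eps_normals (e k) y S"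
    using \<open>?R\<close> e by blast
  then obtain xs zs where
    *: "\<And>k. xs k \<in> S" "\<And>k. dist (xs k) x < e k" "\<And>k. dist (zs k) z < e k"
       "\<And>k. zs k \<in> eps_normals (e k) (xs k) S"
    by metis
  have "(\<lambda>k. dist (xs k) x) \<longlonglongrightarrow> 0" "(\<lambda>k. dist (zs k) z) \<longlonglongrightarrow> 0"
    using *(2,3) by (auto intro!: tendsto_sandwich[OF _ _ tendsto_const e0] always_eventually
        simp: less_imp_le)
  then have "xs \<longlonglongrightarrow> x" "zs \<longlonglongrightarrow> z"
    by (simp_all add: tendsto_dist_iff[symmetric])
  then show ?L
    unfolding limiting_normal_cone_def using * e e0 by blast
qed

text \<open>The diagonal argument, done with tolerances: half of \<open>e\<close> reaches a nearby
  pair of the graph, the other half reaches a genuine \<epsilon>-normal from there. No condition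
  \<open>x \<in> closure S\<close> has to be carried along, because the cone is empty
  elsewhere.\<close>

lemma closed_limiting_normal_cone_graph:
  "closed {(x, z). z \<in> limiting_normal_cone x S}" (is "closed ?G")
proof -
  have "z \<in> limiting_normal_cone x S" if "(x, z) \<in> closure ?G" for x z
    unfolding limiting_normal_cone_iff
  proof (intro allI impI)
    fix e :: real
    assume "e > 0"
    with that obtain x' z' where
      z': "z' \<in> limiting_normal_cone x' S" and near: "dist (x', z') (x, z) < e/2"
      unfolding closure_approachable by (metis (no_types, lifting) case_prodE half_gt_zero mem_Collect_eq)
    obtain y w where yw: "y \<in> S" "dist y x' < e/2" "dist w z' < e/2"
      "w \<in> eps_normals (e/2) y S"
      using z' \<open>e > 0\<close> unfolding limiting_normal_cone_iff by (meson half_gt_zero)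
    have "dist x' x < e/2" "dist z' z < e/2"
      using near dist_fst_le[of "(x', z')" "(x, z)"] dist_snd_le[of "(x', z')" "(x, z)"] by auto
    then have "dist y x < e" "dist w z < e"
      using yw(2,3) dist_triangle[of y x x'] dist_triangle[of w z z'] by linarith+
    moreover have "w \<in> eps_normals e y S"
      using yw(4) eps_normals_mono[of "e/2" e y S] \<open>e > 0\<close> by auto
    ultimately show "\<exists>y w. y \<in> S \<and> dist y x < e \<and> dist w z < e \<and> w \<in> eps_normals e y S"
      using yw(1) by blast
  qed
  then have "closure ?G \<subseteq> ?G"
    by (intro subrelI CollectI case_prodI)
  then show ?thesis
    by (metis closure_subset_eq)
qed

text \<open>Continuity of \<phi> makes this graph a continuous preimage of the graph of the normal
  cone.\<close>

lemma closed_limiting_subdiff_graph: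
  assumes "continuous_on UNIV \<phi>"
  shows "closed {(x, v). v \<in> limiting_subdiff \<phi> x}"
proof -
  have "{(x, v). v \<in> limiting_subdiff \<phi> x} =
      (\<lambda>q. ((fst q, \<phi> (fst q)), (snd q, -1))) -`
        {(x, z). z \<in> limiting_normal_cone x (epigraph UNIV \<phi>)}"
    by (auto simp: limiting_subdiff_def)
  moreover have "continuous_on UNIV (\<lambda>q :: 'a \<times> 'a. ((fst q, \<phi> (fst q)), (snd q, -1 :: real)))"
    by (intro continuous_intros continuous_on_compose2[OF assms]) auto
  ultimately show ?thesis
    by (simp only: closed_vimage[OF closed_limiting_normal_cone_graph])
qed

text \<open>The normal is tested along the direction \<open>(w, L * norm w)\<close>, which stays in the epigraph.\<close>

lemma eps_normal_epigraph_norm_le: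
  assumes lip: "L-lipschitz_on U \<phi>" and U: "open U" "y \<in> U"
    and epi: "(y, \<alpha>) \<in> epigraph UNIV \<phi>"
    and N: "(w, \<beta>) \<in> eps_normals \<epsilon> (y, \<alpha>) (epigraph UNIV \<phi>)"
    and c: "\<epsilon> < c" "0 \<le> c" and \<beta>: "\<beta> \<le> 0"
  shows "norm w \<le> - \<beta> * L + c * (1 + L)"
proof (cases "w = 0")
  case False
  have L: "0 \<le> L"
    using lip by (rule lipschitz_on_nonneg)
  define q where "q t = (y + t *\<^sub>R w, \<alpha> + L * norm (t *\<^sub>R w))" for t :: real
  have "(q \<longlongrightarrow> q 0) (at_right 0)"
    unfolding q_def by (intro tendsto_intros tendsto_eq_intros) auto
  then have q0: "(q \<longlongrightarrow> (y, \<alpha>)) (at_right 0)"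
    by (simp add: q_def)
  have "((\<lambda>t. y + t *\<^sub>R w) \<longlongrightarrow> y) (at_right 0)"
    using tendsto_fst[OF q0] by (simp add: q_def)
  then have "\<forall>\<^sub>F t in at_right 0. y + t *\<^sub>R w \<in> U"
    using U by (rule topological_tendstoD)
  \<comment> \<open>The Lipschitz bound gives
    \<open>\<phi> (y + t w) \<le> \<phi> y + L * norm (t w)\<close>, and \<alpha> is at least
    \<open>\<phi> y\<close>. Because \<open>w\<close> is nonzero, the curve avoids its base point
    for \<open>t > 0\<close>, as the punctured filter demands.\<close>
  then have "\<forall>\<^sub>F t in at_right 0. q t \<in> epigraph UNIV \<phi> \<and> q t \<noteq> (y, \<alpha>)"
    using eventually_at_right_less[of 0]
  proof eventually_elim
    case (elim t)
    have "\<bar>\<phi> (y + t *\<^sub>R w) - \<phi> y\<bar> \<le> L * norm (t *\<^sub>R w)"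
      using lipschitz_onD[OF lip elim(1) U(2)] by (simp add: dist_norm)
    then show ?case
      using epi elim(2) False by (auto simp: q_def mem_epigraph)
  qed
  then have "filterlim q (at (y, \<alpha>) within epigraph UNIV \<phi>) (at_right 0)"
    using q0 unfolding filterlim_at by auto
  then have "\<forall>\<^sub>F t in at_right 0.
      inner (w, \<beta>) (q t - (y, \<alpha>)) \<le> c * norm (q t - (y, \<alpha>))"
    using eps_normals_eventually[OF N c(1)] by (rule eventually_compose_filterlim[rotated])
  then have "\<forall>\<^sub>F t in at_right 0. (0::real) < t \<and>
      inner (w, \<beta>) (q t - (y, \<alpha>)) \<le> c * norm (q t - (y, \<alpha>))"
    using eventually_at_right_less[of "0::real"] by eventually_elim auto
  then obtain t where t: "t > 0"
    "inner (w, \<beta>) (q t - (y, \<alpha>)) \<le> c * norm (q t - (y, \<alpha>))"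
    by (auto dest: eventually_happens)
  have "norm (q t - (y, \<alpha>)) \<le> t * norm w + L * (t * norm w)"
    using norm_Pair_le[of "t *\<^sub>R w" "L * norm (t *\<^sub>R w)"] t(1) L by (simp add: q_def)
  then have "inner (w, \<beta>) (q t - (y, \<alpha>)) \<le> c * (t * norm w + L * (t * norm w))"
    using t(2) c(2) by (meson mult_left_mono order_trans)
  \<comment> \<open>The inner product is \<open>t * norm w ^ 2 + \<beta> * L * t * norm w\<close>,
    so the positive factor \<open>t * norm w\<close> cancels from both sides.\<close>
  then have "t * norm w * (norm w + \<beta> * L) \<le> t * norm w * (c * (1 + L))"
    using t(1) by (simp add: q_def power2_norm_eq_inner[symmetric] power2_eq_square algebra_simps)
  then have "norm w + \<beta> * L \<le> c * (1 + L)"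
    using t(1) False by (simp add: mult_le_cancel_left_pos)
  then show ?thesis
    by simp
next
  \<comment> \<open>The claim is now that the right-hand side is nonnegative, which is where the
    sign of \<beta> enters.\<close>
  case True
  have L: "0 \<le> L"
    using lip by (rule lipschitz_on_nonneg)
  then show ?thesis
    using True mult_nonpos_nonneg[OF \<beta> L] mult_nonneg_nonneg[OF c(2), of "1 + L"] L by simp
qed

text \<open>Approximating normals \<open>(w, \<beta>)\<close> have \<beta> near -1, so the preceding
  bound on \<open>norm w\<close> tends to \<open>L\<close> as the tolerance shrinks.\<close>

lemma limiting_subdiff_norm_le:
  assumes lip: "L-lipschitz_on U \<phi>" and U: "open U" "x \<in> U"
    and v: "v \<in> limiting_subdiff \<phi> x"
  shows "norm v \<le> L"
proof (rule field_le_epsilon)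
  fix e :: real
  assume "e > 0"
  have L: "0 \<le> L"
    using lip by (rule lipschitz_on_nonneg)
  obtain \<rho> where \<rho>: "\<rho> > 0" "ball x \<rho> \<subseteq> U"
    using U openE by blast
  \<comment> \<open>The bound \<open>\<rho>\<close> keeps the base point in \<open>U\<close>, the
    bound 1 forces \<beta> to be negative, and the last one pays for the total excess
    \<open>d * L + 2 * d * (1 + L) + d = 3 * d * (L + 1)\<close>.\<close>
  define d where "d = Min {\<rho>, 1, e / (3 * (L + 1))}"
  have "d > 0"
    using \<rho> \<open>e > 0\<close> L by (simp add: d_def)
  have d: "d \<le> \<rho>" "d \<le> 1" "d \<le> e / (3 * (L + 1))"
    by (simp_all add: d_def)
  obtain q z where q: "q \<in> epigraph UNIV \<phi>" "dist q (x, \<phi> x) < d" "dist z (v, -1) < d"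
    "z \<in> eps_normals d q (epigraph UNIV \<phi>)"
    using v \<open>d > 0\<close> unfolding limiting_subdiff_def limiting_normal_cone_iff mem_Collect_eq by blast
  obtain y \<alpha> w \<beta> where qz: "q = (y, \<alpha>)" "z = (w, \<beta>)"
    by (metis surj_pair)
  have near: "dist y x < d" "dist w v < d" "\<bar>\<beta> + 1\<bar> < d"
    using q(2,3) dist_fst_le[of q "(x, \<phi> x)"] dist_fst_le[of z "(v, -1)"] dist_snd_le[of z "(v, -1)"]
    by (auto simp: qz dist_real_def)
  have "y \<in> U"
    using near(1) d(1) \<rho>(2) by (auto simp: dist_commute)
  moreover have "\<beta> \<le> 0"
    using near(3) d(2) by linarith
  \<comment> \<open>The normals have degree \<open>d\<close>; the slack is taken to be
    \<open>2 * d\<close>, which is strictly larger.\<close>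
  ultimately have "norm w \<le> - \<beta> * L + (2 * d) * (1 + L)"
    using eps_normal_epigraph_norm_le[OF lip U(1), of y \<alpha> w \<beta> d "2 * d"] q \<open>d > 0\<close>
    by (simp add: qz)
  also have "- \<beta> * L \<le> (1 + d) * L"
    using near(3) L by (intro mult_right_mono) auto
  finally have "norm w \<le> L + d * L + 2 * d * (1 + L)"
    by (simp add: algebra_simps)
  moreover have "norm v \<le> norm w + d"
    using near(2) norm_triangle_sub[of v w] by (simp add: dist_norm norm_minus_commute)
  moreover have "d * (3 * (L + 1)) \<le> e"
    using d(3) L by (simp add: field_simps)
  ultimately show "norm v \<le> L + e"
    by (simp add: algebra_simps)
qed

section \<open>Subdifferentials of locally Lipschitz functions: closed graph and local
  boundedness\<close>

lemma locally_lipschitz_continuous: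
  assumes "locally_lipschitz \<phi>"
  shows "continuous_on UNIV \<phi>"
proof (rule continuous_at_imp_continuous_on, rule ballI)
  fix x
  obtain u L where "u > 0" "L-lipschitz_on (ball x u) \<phi>"
    using assms unfolding locally_lipschitz_def by blast
  then show "isCont \<phi> x"
    using continuous_on_interior[OF lipschitz_on_continuous_on] by (metis centre_in_ball interior_ball)
qed

lemma locally_lipschitz_uminus:
  "locally_lipschitz (\<lambda>x. - \<phi> x :: real)" if "locally_lipschitz \<phi>"
  using that unfolding locally_lipschitz_def by (simp add: lipschitz_on_def dist_minus)

lemma closed_two_sided_subdiff_graph:
  assumes "locally_lipschitz \<phi>"
  shows "closed {(x, v). v \<in> two_sided_subdiff \<phi> x}"
proof -
  have "{(x, v). v \<in> two_sided_subdiff \<phi> x} =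
      {(x, v). v \<in> limiting_subdiff \<phi> x} \<union> {(x, v). v \<in> limiting_subdiff (\<lambda>y. - \<phi> y) x}"
    by (auto simp: two_sided_subdiff_def)
  then show ?thesis
    using assms by (simp add: closed_Un closed_limiting_subdiff_graph
        locally_lipschitz_continuous locally_lipschitz_uminus)
qed

text \<open>One Lipschitz constant on an open ball bounds the subgradients at all of its points, not
  only at the centre.\<close>

lemma limiting_subdiff_locally_bounded:
  assumes "locally_lipschitz \<phi>"
  shows "\<exists>B. \<forall>\<^sub>F y in nhds x. \<forall>v \<in> limiting_subdiff \<phi> y. norm v \<le> B"
proof -
  obtain u L where u: "u > 0" "L-lipschitz_on (ball x u) \<phi>"
    using assms unfolding locally_lipschitz_def by blast
  have "\<forall>\<^sub>F y in nhds x. y \<in> ball x u"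
    using u(1) by (intro eventually_nhds_in_open) auto
  then have "\<forall>\<^sub>F y in nhds x. \<forall>v \<in> limiting_subdiff \<phi> y. norm v \<le> L"
    by eventually_elim (auto intro: limiting_subdiff_norm_le[OF u(2)])
  then show ?thesis ..
qed

lemma two_sided_subdiff_locally_bounded:
  assumes "locally_lipschitz \<phi>"
  shows "\<exists>B. \<forall>\<^sub>F y in nhds x. \<forall>v \<in> two_sided_subdiff \<phi> y. norm v \<le> B"
proof -
  obtain A B where
    "\<forall>\<^sub>F y in nhds x. \<forall>v \<in> limiting_subdiff \<phi> y. norm v \<le> A"
    "\<forall>\<^sub>F y in nhds x. \<forall>v \<in> limiting_subdiff (\<lambda>y. - \<phi> y) y. norm v \<le> B"
    using limiting_subdiff_locally_bounded[OF assms]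
      limiting_subdiff_locally_bounded[OF locally_lipschitz_uminus[OF assms]] by blast
  then have "\<forall>\<^sub>F y in nhds x. \<forall>v \<in> two_sided_subdiff \<phi> y. norm v \<le> max A B"
    by eventually_elim (auto simp: two_sided_subdiff_def le_max_iff_disj)
  then show ?thesis ..
qed

subsection \<open>Passing to the limit in weighted sums\<close>

text \<open>Bolzano-Weierstrass, one index at a time: refining the subsequence for a new index
  preserves the limits already found.\<close>

lemma finite_family_convergent_subsequence:
  fixes u :: "nat \<Rightarrow> 'i \<Rightarrow> 'a::{heine_borel, real_normed_vector}"
  assumes "finite I" and "\<And>i. i \<in> I \<Longrightarrow> Bseq (\<lambda>n. u n i)"
  shows "\<exists>s l. strict_mono s \<and> (\<forall>i\<in>I. (\<lambda>n. u (s n) i) \<longlonglongrightarrow> l i)"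
  using assms
proof (induction I)
  case empty
  then show ?case
    using strict_mono_id by auto
next
  case (insert j I)
  then obtain s l where s: "strict_mono s" "\<And>i. i \<in> I \<Longrightarrow> (\<lambda>n. u (s n) i) \<longlonglongrightarrow> l i"
    by blast
  have "Bseq (\<lambda>n. u (s n) j)"
    using insert.prems[of j] Bseq_subseq[of "\<lambda>n. u n j" s] by simp
  then obtain k t where t: "strict_mono t" "(\<lambda>n. u (s (t n)) j) \<longlonglongrightarrow> k"
    using bounded_imp_convergent_subsequence[of "\<lambda>n. u (s n) j"]
    by (auto simp: Bseq_eq_bounded o_def)
  have "(\<lambda>n. u ((s \<circ> t) n) i) \<longlonglongrightarrow> (l(j := k)) i" if "i \<in> insert j I" for i
    using that t insert.hyps LIMSEQ_subseq_LIMSEQ[OF s(2) t(1), of i] by (auto simp: o_def)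
  moreover have "strict_mono (s \<circ> t)"
    using s(1) t(1) by (rule strict_mono_o)
  ultimately show ?case
    by blast
qed

lemma weighted_set_sum_scaleR:
  assumes "a \<in> weighted_set_sum I w C"
  shows "t *\<^sub>R a \<in> weighted_set_sum I (\<lambda>i. t * w i) C"
  using assms by (auto simp: weighted_set_sum_def scaleR_sum_right)

text \<open>The compactness step, used for objectives, inequalities and equalities in turn. Local
  boundedness makes the chosen subgradients converge along a subsequence, and the closed graph
  places their limits in \<open>C i x\<close>, even where the limit weight is zero.\<close>

lemma weighted_set_sum_convergent_subsequence:
  fixes C :: "nat \<Rightarrow> 'a::euclidean_space \<Rightarrow> 'a set"
  assumes "finite I" and y: "y \<longlonglongrightarrow> x"
    and closed: "\<And>i. i \<in> I \<Longrightarrow> closed {(x, v). v \<in> C i x}"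
    and bound: "\<And>i. i \<in> I \<Longrightarrow> \<exists>B. \<forall>\<^sub>F y in nhds x. \<forall>v \<in> C i y. norm v \<le> B"
    and w: "\<And>i. i \<in> I \<Longrightarrow> Bseq (\<lambda>n. w n i)"
    and a: "\<And>n. a n \<in> weighted_set_sum I (w n) (\<lambda>i. C i (y n))"
  obtains s :: "nat \<Rightarrow> nat" and w' a' where "strict_mono s"
    and "\<And>i. i \<in> I \<Longrightarrow> (\<lambda>n. w (s n) i) \<longlonglongrightarrow> w' i" and "(\<lambda>n. a (s n)) \<longlonglongrightarrow> a'"
    and "a' \<in> weighted_set_sum I w' (\<lambda>i. C i x)"
proof -
  have "\<forall>n. \<exists>v. a n = (\<Sum>i\<in>I. w n i *\<^sub>R v i) \<and> (\<forall>i\<in>I. v i \<in> C i (y n))"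
    using a by (auto simp: weighted_set_sum_def)
  then obtain v where v: "\<And>n. a n = (\<Sum>i\<in>I. w n i *\<^sub>R v n i)" "\<And>n i. i \<in> I \<Longrightarrow> v n i \<in> C i (y n)"
    by metis
  \<comment> \<open>Weights and subgradients are paired so that a single extraction handles both.
    The bound on subgradients holds only near \<open>x\<close>, hence for all large
    \<open>n\<close>, which is enough for \<open>Bseq\<close>.\<close>
  have "Bseq (\<lambda>n. (w n i, v n i))" if i: "i \<in> I" for i
  proof -
    obtain B where "\<forall>\<^sub>F y in nhds x. \<forall>v \<in> C i y. norm v \<le> B"
      using bound[OF i] by blast
    then have "\<forall>\<^sub>F n in sequentially. \<forall>v \<in> C i (y n). norm v \<le> B"
      using y by (rule eventually_compose_filterlim)
    then have "\<forall>\<^sub>F n in sequentially. norm (v n i) \<le> B"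
      by (rule eventually_mono) (use v(2)[OF i] in auto)
    then have "Bseq (\<lambda>n. v n i)"
      by (rule BfunI)
    then have "bounded (range (\<lambda>n. w n i) \<times> range (\<lambda>n. v n i))"
      using w[OF i] by (simp add: Bseq_eq_bounded bounded_Times)
    then show ?thesis
      unfolding Bseq_eq_bounded by (rule bounded_subset) auto
  qed
  from finite_family_convergent_subsequence[OF \<open>finite I\<close>, of "\<lambda>n i. (w n i, v n i)", OF this]
  obtain s l where s: "strict_mono s"
    and l: "\<And>i. i \<in> I \<Longrightarrow> (\<lambda>n. (w (s n) i, v (s n) i)) \<longlonglongrightarrow> l i"
    by blast
  have wl: "(\<lambda>n. w (s n) i) \<longlonglongrightarrow> fst (l i)" and vl: "(\<lambda>n. v (s n) i) \<longlonglongrightarrow> snd (l i)" if "i \<in> I" for i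
    using tendsto_fst[OF l[OF that]] tendsto_snd[OF l[OF that]] by simp_all
  have "snd (l i) \<in> C i x" if i: "i \<in> I" for i
  proof -
    have "(\<lambda>n. (y (s n), v (s n) i)) \<longlonglongrightarrow> (x, snd (l i))"
      using LIMSEQ_subseq_LIMSEQ[OF y s] vl[OF i] by (intro tendsto_Pair) (simp_all add: o_def)
    moreover have "(y (s n), v (s n) i) \<in> {(x, v). v \<in> C i x}" for n
      using v(2)[OF i] by simp
    ultimately have "(x, snd (l i)) \<in> {(x, v). v \<in> C i x}"
      using closed_sequentially[OF closed[OF i], of "\<lambda>n. (y (s n), v (s n) i)"] by metis
    then show ?thesis
      by simp
  qed
  then have "(\<Sum>i\<in>I. fst (l i) *\<^sub>R snd (l i)) \<in> weighted_set_sum I (\<lambda>i. fst (l i)) (\<lambda>i. C i x)"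
    by (auto simp: weighted_set_sum_def)
  moreover have "(\<lambda>n. a (s n)) \<longlonglongrightarrow> (\<Sum>i\<in>I. fst (l i) *\<^sub>R snd (l i))"
    unfolding v(1) by (intro tendsto_sum tendsto_scaleR wl vl)
  ultimately show thesis
    by (intro that[OF s wl])
qed

text \<open>An infimum below \<open>1 / (n + 1)\<close> yields a vector of smaller norm. The measure
  may be infinite at early indices, so vectors are selected only along a subsequence, which also
  avoids the meaningless index 0.\<close>

lemma stationarity_measure_subsequence:
  assumes lim: "(\<lambda>k. stationarity_measure p m r f g h (x k) (lam k) (\<mu> k) (\<tau> k)) \<longlonglongrightarrow> 0"
  obtains s v where "strict_mono s" "\<And>n. s n \<ge> 1" "v \<longlonglongrightarrow> 0"
    "\<And>n. v n \<in> lagrangian_sum p m r f g h (x (s n)) (lam (s n)) (\<mu> (s n)) (\<tau> (s n))"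
proof -
  let ?L = "\<lambda>k. lagrangian_sum p m r f g h (x k) (lam k) (\<mu> k) (\<tau> k)"
  let ?P = "\<lambda>n k. k \<ge> 1 \<and> (\<exists>v \<in> ?L k. norm v < inverse (real (Suc n)))"
  have ev: "\<forall>\<^sub>F k in sequentially. ?P n k" for n
  proof -
    have "\<forall>\<^sub>F k in sequentially.
        stationarity_measure p m r f g h (x k) (lam k) (\<mu> k) (\<tau> k) < ereal (inverse (real (Suc n)))"
      using lim by (rule order_tendstoD(2)) simp
    then show ?thesis
      using eventually_ge_at_top[of 1]
      by eventually_elim (auto simp: stationarity_measure_def INF_less_iff)
  qed
  \<comment> \<open>The property holds for all large \<open>k\<close>, so dependent choice can make
    each index exceed the previous one.\<close>
  have "\<exists>k'. ?P n k' \<and> k < k'" for n k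
    using eventually_happens[OF eventually_conj[OF ev eventually_gt_at_top[of k]]] by simp
  then obtain s where s: "\<And>n. ?P n (s n)" "\<And>n. s n < s (Suc n)"
    using dependent_nat_choice[of ?P "\<lambda>_ k k'. k < k'"] ev[THEN eventually_happens] by (simp only: simp_thms) blast
  then obtain v where v: "\<And>n. v n \<in> ?L (s n)" "\<And>n. norm (v n) < inverse (real (Suc n))"
    by metis
  have "v \<longlonglongrightarrow> 0"
    by (rule Lim_null_comparison[OF always_eventually[OF allI] LIMSEQ_inverse_real_of_nat])
      (rule less_imp_le[OF v(2)])
  with that s v show thesis
    by (auto simp: strict_mono_Suc_iff)
qed

section \<open>From approximate multipliers to exact ones under quasi-normality\<close>

theorem theorem3p3:
  fixes p m r :: nat
    and f g h :: "nat \<Rightarrow> real ^ 'n \<Rightarrow> real"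
    and xbar :: "real ^ 'n"
    and x :: "nat \<Rightarrow> real ^ 'n"
    and lam \<mu> \<tau> :: "nat \<Rightarrow> nat \<Rightarrow> real"
  assumes "\<And>l. l \<in> {1..p} \<Longrightarrow> locally_lipschitz (f l)"
    and "\<And>i. i \<in> {1..m} \<Longrightarrow> locally_lipschitz (g i)"
    and "\<And>j. j \<in> {1..r} \<Longrightarrow> locally_lipschitz (h j)"
    and "xbar \<in> feasible_set m r g h"
    and "AKKT p m r f g h xbar x lam \<mu> \<tau>"
    and "\<And>k. k \<ge> 1 \<Longrightarrow> \<exists>b>0. \<exists>c>0.
           (\<forall>i\<in>{1..m}. \<mu> k i = b * max (g i (x k)) 0 \<and> b * max (g i (x k)) 0 \<ge> 0) \<and>
           (\<forall>j\<in>{1..r}. \<tau> k j = c * h j (x k) \<and> c * h j (x k) \<ge> 0)"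
    and "QNCQ m r g h xbar"
  shows "KKT p m r f g h xbar"
proof -
  have \<mu>_nonneg: "\<mu> k i \<ge> 0" if "k \<ge> 1" "i \<in> {1..m}" for k i
    using assms(5) that by (simp add: AKKT_def)
  have lam_nonneg: "lam k l \<ge> 0" if "k \<ge> 1" "l \<in> {1..p}" for k l
    using assms(5) that by (simp add: AKKT_def)
  have \<tau>_nonneg: "\<tau> k j \<ge> 0" if "k \<ge> 1" "j \<in> {1..r}" for k j
    using assms(6)[OF that(1)] that(2) by auto
  have lam_sum: "(\<Sum>l\<in>{1..p}. lam k l) = 1" if "k \<ge> 1" for k
    using assms(5) that by (simp add: AKKT_def)
  have x_lim: "x \<longlonglongrightarrow> xbar"
    and meas: "(\<lambda>k. stationarity_measure p m r f g h (x k) (lam k) (\<mu> k) (\<tau> k)) \<longlonglongrightarrow> 0"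
    and inactive: "\<And>i. i \<in> {1..m} \<Longrightarrow> g i xbar < 0 \<Longrightarrow> \<forall>\<^sub>F k in sequentially. \<mu> k i = 0"
    using assms(5) by (simp_all add: AKKT_def)

  obtain s0 v where s0: "strict_mono s0" "\<And>n. s0 n \<ge> 1" and v: "v \<longlonglongrightarrow> 0"
    and v_mem: "\<And>n. v n \<in> lagrangian_sum p m r f g h
      (x (s0 n)) (lam (s0 n)) (\<mu> (s0 n)) (\<tau> (s0 n))"
    using stationarity_measure_subsequence[OF meas] by blast
  \<comment> \<open>The leading 1 is the sum of the objective multipliers, so \<open>t n\<close> is
    the reciprocal of the total mass. No absolute values are needed, as the sign hypothesis makes
    the \<tau> nonnegative.\<close>
  define t where "t n = 1 / (1 + (\<Sum>i\<in>{1..m}. \<mu> (s0 n) i) + (\<Sum>j\<in>{1..r}. \<tau> (s0 n) j))" for n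
  define w1 where "w1 n l = t n * lam (s0 n) l" for n l
  define w2 where "w2 n i = t n * \<mu> (s0 n) i" for n i
  define w3 where "w3 n j = t n * \<tau> (s0 n) j" for n j
  define y where "y n = x (s0 n)" for n
  have denom: "1 + (\<Sum>i\<in>{1..m}. \<mu> (s0 n) i) + (\<Sum>j\<in>{1..r}. \<tau> (s0 n) j) \<ge> 1" for n
    using sum_nonneg[of "{1..m}" "\<mu> (s0 n)"] sum_nonneg[of "{1..r}" "\<tau> (s0 n)"]
      \<mu>_nonneg[OF s0(2)] \<tau>_nonneg[OF s0(2)] by simp
  have t: "0 < t n" "t n \<le> 1" for n
    using denom[of n] by (auto simp: t_def)
  have w_nonneg: "l \<in> {1..p} \<Longrightarrow> w1 n l \<ge> 0" "i \<in> {1..m} \<Longrightarrow> w2 n i \<ge> 0"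
    "j \<in> {1..r} \<Longrightarrow> w3 n j \<ge> 0" for n l i j
    using t(1)[of n] s0(2) lam_nonneg \<mu>_nonneg \<tau>_nonneg by (simp_all add: w1_def w2_def w3_def)
  have w1_sum: "(\<Sum>l\<in>{1..p}. w1 n l) = t n" for n
    using lam_sum[OF s0(2)] by (simp add: w1_def sum_distrib_left[symmetric])
  have "t n * (1 + (\<Sum>i\<in>{1..m}. \<mu> (s0 n) i) + (\<Sum>j\<in>{1..r}. \<tau> (s0 n) j)) = 1" for n
    using denom[of n] by (simp add: t_def)
  \<comment> \<open>Total mass one bounds every weight, and it passes to the limit, where it
    prevents all multipliers from vanishing.\<close>
  then have w_sum: "(\<Sum>l\<in>{1..p}. w1 n l) + (\<Sum>i\<in>{1..m}. w2 n i) + (\<Sum>j\<in>{1..r}. w3 n j) = 1" for n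
    by (simp only: w1_sum w2_def w3_def sum_distrib_left[symmetric] distrib_left mult_1_right)
  have sums_nonneg: "(\<Sum>l\<in>{1..p}. w1 n l) \<ge> 0" "(\<Sum>i\<in>{1..m}. w2 n i) \<ge> 0"
    "(\<Sum>j\<in>{1..r}. w3 n j) \<ge> 0" for n
    by (auto intro!: sum_nonneg w_nonneg)
  have w_le: "l \<in> {1..p} \<Longrightarrow> w1 n l \<le> 1" "i \<in> {1..m} \<Longrightarrow> w2 n i \<le> 1"
    "j \<in> {1..r} \<Longrightarrow> w3 n j \<le> 1" for n l i j
    using w_sum[of n] sums_nonneg[of n] w_nonneg
      member_le_sum[of l "{1..p}" "w1 n"] member_le_sum[of i "{1..m}" "w2 n"]
      member_le_sum[of j "{1..r}" "w3 n"]
    by force+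
  have Bseqs: "l \<in> {1..p} \<Longrightarrow> Bseq (\<lambda>n. w1 n l)" "i \<in> {1..m} \<Longrightarrow> Bseq (\<lambda>n. w2 n i)"
    "j \<in> {1..r} \<Longrightarrow> Bseq (\<lambda>n. w3 n j)" for l i j
    using w_nonneg w_le by (auto intro!: BseqI'[where K = 1])

  have "\<exists>a b c. v n = a + (b + c) \<and>
      a \<in> weighted_set_sum {1..p} (lam (s0 n)) (\<lambda>l. limiting_subdiff (f l) (y n)) \<and>
      b \<in> weighted_set_sum {1..m} (\<mu> (s0 n)) (\<lambda>i. limiting_subdiff (g i) (y n)) \<and>
      c \<in> weighted_set_sum {1..r} (\<tau> (s0 n)) (\<lambda>j. two_sided_subdiff (h j) (y n))" for n
    using v_mem[of n] unfolding lagrangian_sum_def constraint_sum_def y_def by blast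
  then obtain a0 b0 c0 where v_eq: "\<And>n. v n = a0 n + (b0 n + c0 n)"
    and a0: "\<And>n. a0 n \<in> weighted_set_sum {1..p} (lam (s0 n)) (\<lambda>l. limiting_subdiff (f l) (y n))"
    and b0: "\<And>n. b0 n \<in> weighted_set_sum {1..m} (\<mu> (s0 n)) (\<lambda>i. limiting_subdiff (g i) (y n))"
    and c0: "\<And>n. c0 n \<in> weighted_set_sum {1..r} (\<tau> (s0 n)) (\<lambda>j. two_sided_subdiff (h j) (y n))"
    by metis
  define a b c where "a n = t n *\<^sub>R a0 n" and "b n = t n *\<^sub>R b0 n" and "c n = t n *\<^sub>R c0 n" for n
  have a: "a n \<in> weighted_set_sum {1..p} (w1 n) (\<lambda>l. limiting_subdiff (f l) (y n))"
    and b: "b n \<in> weighted_set_sum {1..m} (w2 n) (\<lambda>i. limiting_subdiff (g i) (y n))"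
    and c: "c n \<in> weighted_set_sum {1..r} (w3 n) (\<lambda>j. two_sided_subdiff (h j) (y n))" for n
    using weighted_set_sum_scaleR[OF a0[of n], of "t n"] weighted_set_sum_scaleR[OF b0[of n], of "t n"]
      weighted_set_sum_scaleR[OF c0[of n], of "t n"]
    by (simp_all add: a_def b_def c_def w1_def[abs_def] w2_def[abs_def] w3_def[abs_def])
  \<comment> \<open>Since \<open>t n \<le> 1\<close>, normalizing can only shrink the
    residual.\<close>
  have "norm (a n + (b n + c n)) \<le> norm (v n)" for n
    using t[of n] by (simp add: a_def b_def c_def v_eq scaleR_add_right[symmetric] mult_left_le_one_le)
  then have abc: "(\<lambda>n. a n + (b n + c n)) \<longlonglongrightarrow> 0"
    by (rule Lim_null_comparison[OF always_eventually[OF allI] tendsto_norm_zero[OF v]])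
  have y: "y \<longlonglongrightarrow> xbar"
    using LIMSEQ_subseq_LIMSEQ[OF x_lim s0(1)] by (simp add: y_def[abs_def] o_def)

  have f: "closed {(x, v). v \<in> limiting_subdiff (f l) x}"
      "\<exists>B. \<forall>\<^sub>F y in nhds xbar. \<forall>v \<in> limiting_subdiff (f l) y. norm v \<le> B" if "l \<in> {1..p}" for l
    using closed_limiting_subdiff_graph[OF locally_lipschitz_continuous[OF assms(1)[OF that]]]
      limiting_subdiff_locally_bounded[OF assms(1)[OF that]] by simp_all
  have g: "closed {(x, v). v \<in> limiting_subdiff (g i) x}"
      "\<exists>B. \<forall>\<^sub>F y in nhds xbar. \<forall>v \<in> limiting_subdiff (g i) y. norm v \<le> B" if "i \<in> {1..m}" for i
    using closed_limiting_subdiff_graph[OF locally_lipschitz_continuous[OF assms(2)[OF that]]]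
      limiting_subdiff_locally_bounded[OF assms(2)[OF that]] by simp_all
  have h: "closed {(x, v). v \<in> two_sided_subdiff (h j) x}"
      "\<exists>B. \<forall>\<^sub>F y in nhds xbar. \<forall>v \<in> two_sided_subdiff (h j) y. norm v \<le> B" if "j \<in> {1..r}" for j
    using closed_two_sided_subdiff_graph[OF assms(3)[OF that]]
      two_sided_subdiff_locally_bounded[OF assms(3)[OF that]] by simp_all

  \<comment> \<open>Three nested extractions follow, each along the previous subsequence; their
    composite \<open>s\<close> carries all the limits.\<close>
  obtain s1 lam' a' where s1: "strict_mono s1"
    and lam': "\<And>l. l \<in> {1..p} \<Longrightarrow> (\<lambda>n. w1 (s1 n) l) \<longlonglongrightarrow> lam' l"
    and a': "(\<lambda>n. a (s1 n)) \<longlonglongrightarrow> a'"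
      "a' \<in> weighted_set_sum {1..p} lam' (\<lambda>l. limiting_subdiff (f l) xbar)"
    using weighted_set_sum_convergent_subsequence[where C = "\<lambda>l. limiting_subdiff (f l)"
        and w = w1 and a = a and I = "{1..p}", OF finite_atLeastAtMost y f Bseqs(1) a] by blast
  have sub1: "(\<lambda>n. y (s1 n)) \<longlonglongrightarrow> xbar" "i \<in> {1..m} \<Longrightarrow> Bseq (\<lambda>n. w2 (s1 n) i)" for i
    using LIMSEQ_subseq_LIMSEQ[OF y s1] Bseq_subseq[OF Bseqs(2), of i s1] by (simp_all add: o_def)
  obtain s2 \<mu>' b' where s2: "strict_mono s2"
    and \<mu>': "\<And>i. i \<in> {1..m} \<Longrightarrow> (\<lambda>n. w2 (s1 (s2 n)) i) \<longlonglongrightarrow> \<mu>' i"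
    and b': "(\<lambda>n. b (s1 (s2 n))) \<longlonglongrightarrow> b'"
      "b' \<in> weighted_set_sum {1..m} \<mu>' (\<lambda>i. limiting_subdiff (g i) xbar)"
    using weighted_set_sum_convergent_subsequence[where C = "\<lambda>i. limiting_subdiff (g i)"
        and w = "\<lambda>n. w2 (s1 n)" and a = "\<lambda>n. b (s1 n)" and I = "{1..m}",
        OF finite_atLeastAtMost sub1(1) g sub1(2) b] by blast
  have s12: "strict_mono (\<lambda>n. s1 (s2 n))"
    using strict_mono_o[OF s1 s2] by (simp add: o_def)
  have sub2: "(\<lambda>n. y (s1 (s2 n))) \<longlonglongrightarrow> xbar" "j \<in> {1..r} \<Longrightarrow> Bseq (\<lambda>n. w3 (s1 (s2 n)) j)" for j
    using LIMSEQ_subseq_LIMSEQ[OF y s12] Bseq_subseq[OF Bseqs(3), of j "\<lambda>n. s1 (s2 n)"]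
    by (simp_all add: o_def)
  obtain s3 \<tau>' c' where s3: "strict_mono s3"
    and \<tau>': "\<And>j. j \<in> {1..r} \<Longrightarrow> (\<lambda>n. w3 (s1 (s2 (s3 n))) j) \<longlonglongrightarrow> \<tau>' j"
    and c': "(\<lambda>n. c (s1 (s2 (s3 n)))) \<longlonglongrightarrow> c'"
      "c' \<in> weighted_set_sum {1..r} \<tau>' (\<lambda>j. two_sided_subdiff (h j) xbar)"
    using weighted_set_sum_convergent_subsequence[where C = "\<lambda>j. two_sided_subdiff (h j)"
        and w = "\<lambda>n. w3 (s1 (s2 n))" and a = "\<lambda>n. c (s1 (s2 n))" and I = "{1..r}",
        OF finite_atLeastAtMost sub2(1) h sub2(2) c] by blast
  define s where "s n = s1 (s2 (s3 n))" for n
  have s23: "strict_mono (\<lambda>n. s2 (s3 n))"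
    using strict_mono_o[OF s2 s3] by (simp add: o_def)
  have s: "strict_mono s"
    using strict_mono_o[OF s1 s23] by (simp add: s_def[abs_def] o_def)
  have lam'_lim: "(\<lambda>n. w1 (s n) l) \<longlonglongrightarrow> lam' l" if "l \<in> {1..p}" for l
    using LIMSEQ_subseq_LIMSEQ[OF lam'[OF that] s23] by (simp add: s_def o_def)
  have \<mu>'_lim: "(\<lambda>n. w2 (s n) i) \<longlonglongrightarrow> \<mu>' i" if "i \<in> {1..m}" for i
    using LIMSEQ_subseq_LIMSEQ[OF \<mu>'[OF that] s3] by (simp add: s_def o_def)
  have \<tau>'_lim: "(\<lambda>n. w3 (s n) j) \<longlonglongrightarrow> \<tau>' j" if "j \<in> {1..r}" for j
    using \<tau>'[OF that] by (simp add: s_def)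
  have "(\<lambda>n. a (s n) + (b (s n) + c (s n))) \<longlonglongrightarrow> a' + (b' + c')"
    using LIMSEQ_subseq_LIMSEQ[OF a'(1) s23] LIMSEQ_subseq_LIMSEQ[OF b'(1) s3] c'(1)
    by (intro tendsto_add) (simp_all add: s_def o_def)
  moreover have "(\<lambda>n. a (s n) + (b (s n) + c (s n))) \<longlonglongrightarrow> 0"
    using LIMSEQ_subseq_LIMSEQ[OF abc s] by (simp add: o_def)
  ultimately have zero: "a' + (b' + c') = 0"
    using LIMSEQ_unique by blast
  have lam'_nonneg: "lam' l \<ge> 0" if "l \<in> {1..p}" for l
    using lam'_lim[OF that] by (rule LIMSEQ_le_const) (use w_nonneg(1)[OF that] in auto)
  have \<mu>'_nonneg: "\<mu>' i \<ge> 0" if "i \<in> {1..m}" for i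
    using \<mu>'_lim[OF that] by (rule LIMSEQ_le_const) (use w_nonneg(2)[OF that] in auto)
  have "(\<lambda>n. (\<Sum>l\<in>{1..p}. w1 (s n) l) + (\<Sum>i\<in>{1..m}. w2 (s n) i) + (\<Sum>j\<in>{1..r}. w3 (s n) j))
      \<longlonglongrightarrow> (\<Sum>l\<in>{1..p}. lam' l) + (\<Sum>i\<in>{1..m}. \<mu>' i) + (\<Sum>j\<in>{1..r}. \<tau>' j)"
    by (intro tendsto_add tendsto_sum lam'_lim \<mu>'_lim \<tau>'_lim)
  then have sum_one: "(\<Sum>l\<in>{1..p}. lam' l) + (\<Sum>i\<in>{1..m}. \<mu>' i) + (\<Sum>j\<in>{1..r}. \<tau>' j) = 1"
    unfolding w_sum by (rule LIMSEQ_unique[OF tendsto_const, symmetric])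

  show ?thesis
  proof (cases "\<exists>l\<in>{1..p}. lam' l \<noteq> 0")
    case True
    \<comment> \<open>For an inactive constraint (A3) makes the multipliers vanish eventually, so
      their scaled limit is zero; otherwise feasibility gives \<open>g i xbar = 0\<close>.\<close>
    have "\<mu>' i * g i xbar = 0" if i: "i \<in> {1..m}" for i
    proof (cases "g i xbar < 0")
      case True
      have "strict_mono (\<lambda>n. s0 (s n))"
        using strict_mono_o[OF s0(1) s] by (simp add: o_def)
      then have "\<forall>\<^sub>F n in sequentially. \<mu> (s0 (s n)) i = 0"
        using eventually_subseq inactive[OF i True] by blast
      then have "\<forall>\<^sub>F n in sequentially. w2 (s n) i = 0"
        by eventually_elim (simp add: w2_def)
      then have "(\<lambda>n. w2 (s n) i) \<longlonglongrightarrow> 0"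
        by (rule tendsto_eventually)
      then show ?thesis
        using \<mu>'_lim[OF i] LIMSEQ_unique by fastforce
    next
      case False
      then show ?thesis
        using assms(4) i by (force simp: feasible_set_def)
    qed
    moreover have "0 \<in> lagrangian_sum p m r f g h xbar lam' \<mu>' \<tau>'"
      unfolding lagrangian_sum_def constraint_sum_def using zero a'(2) b'(2) c'(2) by force
    ultimately show ?thesis
      unfolding KKT_def using True lam'_nonneg \<mu>'_nonneg by blast
  next
    case False
    \<comment> \<open>All objective weights are zero in the limit, so the bounded subgradients
      contribute nothing and only the constraint terms remain.\<close>
    then have "a' = 0"
      using a'(2) by (auto simp: weighted_set_sum_def)
    then have "0 \<in> constraint_sum m r g h xbar \<mu>' \<tau>'"
      unfolding constraint_sum_def using zero b'(2) c'(2) by force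
    moreover have "(\<exists>i\<in>{1..m}. \<mu>' i \<noteq> 0) \<or> (\<exists>j\<in>{1..r}. \<tau>' j \<noteq> 0)"
    proof (rule ccontr)
      assume "\<not> ?thesis"
      with False sum_one show False
        by simp
    qed
    \<comment> \<open>The witness is \<open>y (s n)\<close> for a large \<open>n\<close>: a positive
      limit makes the finitely many corresponding weights positive from some index on.\<close>
    moreover have "\<exists>z\<in>U. (\<forall>i\<in>{1..m}. \<mu>' i > 0 \<longrightarrow> g i z > 0) \<and>
        (\<forall>j\<in>{1..r}. \<tau>' j \<noteq> 0 \<longrightarrow> \<tau>' j * h j z > 0)" if U: "open U" "xbar \<in> U" for U
    proof -
      have "(\<lambda>n. y (s n)) \<longlonglongrightarrow> xbar"
        using LIMSEQ_subseq_LIMSEQ[OF y s] by (simp add: o_def)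
      then have "\<forall>\<^sub>F n in sequentially. y (s n) \<in> U"
        using U by (rule topological_tendstoD)
      moreover have "\<forall>\<^sub>F n in sequentially. \<forall>i\<in>{1..m}. \<mu>' i > 0 \<longrightarrow> w2 (s n) i > 0"
        by (auto intro!: eventually_ball_finite order_tendstoD(1)[OF \<mu>'_lim])
      moreover have "\<forall>\<^sub>F n in sequentially. \<forall>j\<in>{1..r}. \<tau>' j > 0 \<longrightarrow> w3 (s n) j > 0"
        by (auto intro!: eventually_ball_finite order_tendstoD(1)[OF \<tau>'_lim])
      ultimately have "\<forall>\<^sub>F n in sequentially. y (s n) \<in> U \<and>
          (\<forall>i\<in>{1..m}. \<mu>' i > 0 \<longrightarrow> w2 (s n) i > 0) \<and> (\<forall>j\<in>{1..r}. \<tau>' j > 0 \<longrightarrow> w3 (s n) j > 0)"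
        by eventually_elim blast
      then obtain n where n: "y (s n) \<in> U" "\<forall>i\<in>{1..m}. \<mu>' i > 0 \<longrightarrow> w2 (s n) i > 0"
        "\<forall>j\<in>{1..r}. \<tau>' j > 0 \<longrightarrow> w3 (s n) j > 0"
        by (auto dest: eventually_happens)
      obtain d e where de: "d > 0" "e > 0"
        "\<forall>i\<in>{1..m}. \<mu> (s0 (s n)) i = d * max (g i (y (s n))) 0"
        "\<forall>j\<in>{1..r}. \<tau> (s0 (s n)) j = e * h j (y (s n))"
        using assms(6)[OF s0(2)[of "s n"]] unfolding y_def by blast
      have "g i (y (s n)) > 0" if "i \<in> {1..m}" "\<mu>' i > 0" for i
      proof -
        \<comment> \<open>A positive multiplier is a positive multiple of
          \<open>max (g i (y (s n))) 0\<close>, so the constraint is violated at this point.\<close>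
        have "\<mu> (s0 (s n)) i > 0"
          using n(2) that t(1)[of "s n"] by (simp add: w2_def zero_less_mult_iff)
        then show ?thesis
          using de(1,3) that(1) by (auto simp: zero_less_mult_iff max_def split: if_splits)
      qed
      moreover have "\<tau>' j * h j (y (s n)) > 0" if "j \<in> {1..r}" "\<tau>' j \<noteq> 0" for j
      proof -
        \<comment> \<open>Limits of nonnegative weights are nonnegative, so a nonzero
          \<open>\<tau>' j\<close> is positive, and \<open>h j\<close> only has to be shown
          positive.\<close>
        have "\<tau>' j \<ge> 0"
          using \<tau>'_lim[OF that(1)] by (rule LIMSEQ_le_const) (use w_nonneg(3)[OF that(1)] in auto)
        with that have pos: "\<tau>' j > 0"
          by simp
        then have "\<tau> (s0 (s n)) j > 0"
          using n(3) that(1) t(1)[of "s n"] by (simp add: w3_def zero_less_mult_iff)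
        then show ?thesis
          using pos de(2,4) that(1) by (auto simp: zero_less_mult_iff)
      qed
      ultimately show ?thesis
        using n(1) by blast
    qed
    ultimately show ?thesis
      using assms(7) \<mu>'_nonneg unfolding QNCQ_def by blast
  qed
qed

end
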